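(* Let $p,q\ge1$ be integers and let $M$ be a $(p+q)\times(p+q)$ matrix with real entries. Then $M$ defines a linear self map of $D_{p,q}$ if and only if it defines a linear self map of $D_{p,q}^{\mathbb R}$ in the same manner.
   Context: The generalized ball is $D_{p,q}=\{[z_1,\dots,z_{p+q}]\in\mathbb P^{p+q-1}: |z_1|^2+\dots+|z_p|^2>|z_{p+1}|^2+\dots+|z_{p+q}|^2\}$, where $\mathbb P^{p+q-1}$ is complex projective space. The real generalized ball is $$D_{p,q}^{\mathbb R}=\{[x_1,\dots,x_{p+q}]\in D_{p,q}: x_i/x_j\in\mathbb R\text{ for all } i,j\text{ whenever }x_j\ne0\},$$ i.e. the set of points of $D_{p,q}$ admitting real homogeneous coordinates. A matrix $M$ defines a linear self map of $D_{p,q}$ (respectively $D_{p,q}^{\mathbb R}$) if $[z]\mapsto[Mz]$ is a well-defined map of $D_{p,q}$ into $D_{p,q}$ (respectively of $D_{p,q}^{\mathbb R}$ into $D_{p,q}^{\mathbb R}$); well-definedness means $Mz\neq0$ for every $[z]$ in the domain. *)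

theory Defs
  imports "HOL-Analysis.Analysis"
begin

text \<open>The complex projective space of \<open>complex ^ 'n\<close>: nonzero vectors modulo nonzero complex scalars.
  A point is an equivalence class, i.e. a punctured complex line.\<close>

definition proj_rel :: "((complex ^ 'n) \<times> (complex ^ 'n)) set" where
  "proj_rel = {(z, w). z \<noteq> 0 \<and> w \<noteq> 0 \<and> (\<exists>c. c \<noteq> 0 \<and> w = c *s z)}"

lemma equiv_proj_rel: "equiv (UNIV - {0}) (proj_rel :: ((complex ^ 'n) \<times> (complex ^ 'n)) set)"
proof (rule equivI)
  show "(proj_rel :: ((complex ^ 'n) \<times> (complex ^ 'n)) set) \<subseteq> (UNIV - {0}) \<times> (UNIV - {0})"
    by (auto simp: proj_rel_def)
  show "refl_on (UNIV - {0}) (proj_rel :: ((complex ^ 'n) \<times> (complex ^ 'n)) set)"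
    by (auto simp: proj_rel_def refl_on_def intro!: exI[of _ 1])
  show "sym (proj_rel :: ((complex ^ 'n) \<times> (complex ^ 'n)) set)"
  proof (rule symI)
    fix z w :: "complex ^ 'n"
    assume "(z, w) \<in> proj_rel"
    then obtain c where "z \<noteq> 0" "w \<noteq> 0" "c \<noteq> 0" "w = c *s z"
      by (auto simp: proj_rel_def)
    then have "z = inverse c *s w" "inverse c \<noteq> 0"
      by (simp_all add: vector_smult_assoc)
    with \<open>z \<noteq> 0\<close> \<open>w \<noteq> 0\<close> show "(w, z) \<in> proj_rel"
      unfolding proj_rel_def by blast
  qed
  show "trans (proj_rel :: ((complex ^ 'n) \<times> (complex ^ 'n)) set)"
  proof (rule transI)
    fix x y z :: "complex ^ 'n"
    assume "(x, y) \<in> proj_rel" "(y, z) \<in> proj_rel"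
    then obtain c d where "x \<noteq> 0" "z \<noteq> 0" "c \<noteq> 0" "d \<noteq> 0" "y = c *s x" "z = d *s y"
      by (auto simp: proj_rel_def)
    then have "z = (d * c) *s x" "d * c \<noteq> 0"
      by (simp_all add: vector_smult_assoc)
    with \<open>x \<noteq> 0\<close> \<open>z \<noteq> 0\<close> show "(x, z) \<in> proj_rel"
      unfolding proj_rel_def by blast
  qed
qed

definition proj_space :: "(complex ^ 'n) set set" where
  "proj_space = (UNIV - {0}) // proj_rel"

text \<open>The point with homogeneous coordinates \<open>z\<close>; only meaningful for \<open>z \<noteq> 0\<close>.\<close>

definition proj_point :: "complex ^ 'n \<Rightarrow> (complex ^ 'n) set" where
  "proj_point z = proj_rel `` {z}"

lemma proj_point_in_proj_space_iff: "proj_point z \<in> proj_space \<longleftrightarrow> z \<noteq> 0"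
proof
  assume "proj_point z \<in> proj_space"
  then have "proj_point z \<noteq> {}"
    unfolding proj_space_def using in_quotient_imp_non_empty[OF equiv_proj_rel] by blast
  then show "z \<noteq> 0"
    by (auto simp: proj_point_def proj_rel_def)
qed (auto simp: proj_point_def proj_space_def quotientI)

text \<open>The integers \<open>p, q \<ge> 1\<close> are the cardinalities of the finite (nonempty) index types \<open>'p\<close> and
  \<open>'q\<close>; the first \<open>p\<close> coordinates are those indexed by \<open>Inl\<close>, the last \<open>q\<close> those indexed by \<open>Inr\<close>.\<close>

definition gen_ball :: "(complex ^ ('p::finite + 'q::finite)) set set" where
  "gen_ball = {proj_point z | z. z \<noteq> 0 \<and>
     (\<Sum>i\<in>UNIV. (cmod (z $ Inl i))\<^sup>2) > (\<Sum>j\<in>UNIV. (cmod (z $ Inr j))\<^sup>2)}"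

definition real_gen_ball :: "(complex ^ ('p::finite + 'q::finite)) set set" where
  "real_gen_ball = {proj_point x | x. x \<noteq> 0 \<and> proj_point x \<in> gen_ball \<and>
     (\<forall>i j. x $ j \<noteq> 0 \<longrightarrow> x $ i / x $ j \<in> \<real>)}"

text \<open>\<open>M\<close> defines a linear self map of \<open>S\<close>: \<open>M z \<noteq> 0\<close> for all \<open>[z] \<in> S\<close>, and \<open>[z] \<mapsto> [M z]\<close> is a
  map \<open>f\<close> from \<open>S\<close> into \<open>S\<close>.\<close>

definition defines_linear_self_map :: "complex ^ 'n ^ 'n \<Rightarrow> (complex ^ 'n) set set \<Rightarrow> bool" where
  "defines_linear_self_map M S \<longleftrightarrow>
     (\<forall>z. z \<noteq> 0 \<and> proj_point z \<in> S \<longrightarrow> M *v z \<noteq> 0) \<and>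
     (\<exists>f. f \<in> S \<rightarrow> S \<and> (\<forall>z. z \<noteq> 0 \<and> proj_point z \<in> S \<longrightarrow> f (proj_point z) = proj_point (M *v z)))"

end

theory Submission imports Defs begin

text \<open>Let \<open>Q z = \<Sum>|z\<^sub>i|\<^sup>2 - \<Sum>|z\<^sub>j|\<^sup>2\<close> be the Hermitian form defining the ball and \<open>B\<close> the
  complex bilinear extension of its restriction to real vectors. Multiplying \<open>z\<close> by a suitable scalar makes
  \<open>B z z\<close> purely imaginary; then the real and the imaginary part of \<open>z\<close> both have \<open>Q\<close>-value \<open>Q z / 2\<close>.
  A real matrix acts on the two parts separately, so positivity of \<open>Q\<close> on the images of positive
  real vectors gives positivity on the images of positive complex vectors.\<close>

definition herm_form :: "complex ^ ('p::finite + 'q::finite) \<Rightarrow> real" where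
  "herm_form z = (\<Sum>i\<in>UNIV. (cmod (z $ Inl i))\<^sup>2) - (\<Sum>j\<in>UNIV. (cmod (z $ Inr j))\<^sup>2)"

text \<open>This is the diagonal value \<open>B z z\<close>, not \<open>B\<close> itself. Squares
  without moduli make a scalar enter as \<open>c\<^sup>2\<close>, so rescaling can rotate the value
  to any argument.\<close>

definition bilin_form :: "complex ^ ('p::finite + 'q::finite) \<Rightarrow> complex" where
  "bilin_form z = (\<Sum>i\<in>UNIV. (z $ Inl i)\<^sup>2) - (\<Sum>j\<in>UNIV. (z $ Inr j)\<^sup>2)"

text \<open>Real vectors stay inside the complex space, so that \<open>M\<close> and
  \<open>herm_form\<close> apply to them directly.\<close>

definition Re_vec :: "complex ^ 'n \<Rightarrow> complex ^ 'n" where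
  "Re_vec z = (\<chi> i. of_real (Re (z $ i)))"

definition Im_vec :: "complex ^ 'n \<Rightarrow> complex ^ 'n" where
  "Im_vec z = (\<chi> i. of_real (Im (z $ i)))"

lemma herm_form_zero [simp]: "herm_form 0 = 0"
  by (simp add: herm_form_def)

lemma herm_form_scale: "herm_form (c *s z) = (cmod c)\<^sup>2 * herm_form z"
  by (simp add: herm_form_def norm_mult power_mult_distrib right_diff_distrib sum_distrib_left)

lemma bilin_form_scale: "bilin_form (c *s z) = c\<^sup>2 * bilin_form z"
  by (simp add: bilin_form_def power_mult_distrib right_diff_distrib sum_distrib_left)

lemma herm_form_scale_pos_iff: "c \<noteq> 0 \<Longrightarrow> herm_form (c *s z) > 0 \<longleftrightarrow> herm_form z > 0"
  by (simp add: herm_form_scale zero_less_mult_iff)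

lemma herm_form_Re_Im: "herm_form z = herm_form (Re_vec z) + herm_form (Im_vec z)"
  by (simp add: herm_form_def Re_vec_def Im_vec_def cmod_power2 sum.distrib)

text \<open>Coordinatewise, the real part of a square is the square of the real part minus that of
  the imaginary part.\<close>

lemma Re_bilin_form: "Re (bilin_form z) = herm_form (Re_vec z) - herm_form (Im_vec z)"
  by (simp add: bilin_form_def herm_form_def Re_vec_def Im_vec_def power2_eq_square sum_subtractf)

lemma exists_scale_Re_bilin_form_eq_0: "\<exists>c. c \<noteq> 0 \<and> Re (bilin_form (c *s z)) = 0"
proof (cases "bilin_form z = 0")
  case True
  then show ?thesis by (intro exI[of _ 1]) simp
next
  case False
  \<comment> \<open>With this \<open>?c\<close> the rescaled value is \<open>\<i>\<close> times the
    squared modulus of \<open>bilin_form z\<close>, hence purely imaginary.\<close>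
  let ?c = "csqrt (\<i> * cnj (bilin_form z))"
  have "bilin_form (?c *s z) = \<i> * (cnj (bilin_form z) * bilin_form z)"
    by (simp add: bilin_form_scale mult.assoc)
  also have "Re \<dots> = 0"
    by simp
  finally show ?thesis
    using False by (intro exI[of _ ?c]) auto
qed

lemma Re_vec_mult:
  assumes "\<forall>i j. M $ i $ j \<in> \<real>"
  shows "Re_vec (M *v z) = M *v Re_vec z"
proof -
  have "Re (M $ i $ j * z $ j) = Re (M $ i $ j) * Re (z $ j)" "of_real (Re (M $ i $ j)) = M $ i $ j" for i j
    using assms by (auto simp: complex_is_Real_iff complex_eq_iff)
  then show ?thesis
    by (simp add: vec_eq_iff Re_vec_def matrix_vector_mult_def del: times_complex.sel)
qed

lemma Im_vec_mult:
  assumes "\<forall>i j. M $ i $ j \<in> \<real>"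
  shows "Im_vec (M *v z) = M *v Im_vec z"
proof -
  have "Im (M $ i $ j * z $ j) = Re (M $ i $ j) * Im (z $ j)" "of_real (Re (M $ i $ j)) = M $ i $ j" for i j
    using assms by (auto simp: complex_is_Real_iff complex_eq_iff)
  then show ?thesis
    by (simp add: vec_eq_iff Im_vec_def matrix_vector_mult_def del: times_complex.sel)
qed

lemma herm_form_mult_pos:
  assumes M: "\<forall>i j. M $ i $ j \<in> \<real>"
    and pos: "\<And>x. (\<forall>i. x $ i \<in> \<real>) \<Longrightarrow> herm_form x > 0 \<Longrightarrow> herm_form (M *v x) > 0"
    and z: "herm_form z > 0"
  shows "herm_form (M *v z) > 0"
proof -
  obtain c where c: "c \<noteq> 0" "Re (bilin_form (c *s z)) = 0"
    using exists_scale_Re_bilin_form_eq_0 by blast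
  define w where "w = c *s z"
  have "herm_form w > 0"
    using c z by (simp add: w_def herm_form_scale_pos_iff)
  moreover have "herm_form (Re_vec w) = herm_form (Im_vec w)"
    using c Re_bilin_form[of w] by (simp add: w_def)
  ultimately have "herm_form (Re_vec w) > 0" "herm_form (Im_vec w) > 0"
    using herm_form_Re_Im[of w] by simp_all
  then have "herm_form (M *v Re_vec w) > 0" "herm_form (M *v Im_vec w) > 0"
    by (auto intro!: pos simp: Re_vec_def Im_vec_def)
  \<comment> \<open>As \<open>M\<close> is real, the real and imaginary parts of
    \<open>M *v w\<close> are the two images just treated, and their forms add up.\<close>
  then have "herm_form (M *v w) > 0"
    using herm_form_Re_Im[of "M *v w"] by (simp add: Re_vec_mult Im_vec_mult M)
  then show ?thesis
    using c by (simp add: w_def vector_scalar_commute herm_form_scale_pos_iff)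
qed

lemma proj_point_eq_iff:
  assumes "z \<noteq> 0" "w \<noteq> 0"
  shows "proj_point z = proj_point w \<longleftrightarrow> (\<exists>c. c \<noteq> 0 \<and> w = c *s z)"
  using assms eq_equiv_class_iff[OF equiv_proj_rel, of z w]
  by (simp add: proj_point_def proj_rel_def)

lemma proj_point_scale:
  assumes "z \<noteq> 0" "c \<noteq> 0"
  shows "proj_point (c *s z) = proj_point z"
  using assms proj_point_eq_iff[of z "c *s z"] by auto

lemma proj_point_in_gen_ball_iff:
  assumes "z \<noteq> 0"
  shows "proj_point z \<in> gen_ball \<longleftrightarrow> herm_form z > 0"
proof
  assume "proj_point z \<in> gen_ball"
  then obtain w where "w \<noteq> 0" "proj_point z = proj_point w" "herm_form w > 0"
    by (auto simp: gen_ball_def herm_form_def)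
  then show "herm_form z > 0"
    using assms by (auto simp: proj_point_eq_iff herm_form_scale_pos_iff)
qed (use assms in \<open>auto simp: gen_ball_def herm_form_def\<close>)

text \<open>This replaces the condition on ratios by a real representative: dividing by one nonzero
  coordinate turns every coordinate into a ratio.\<close>

lemma proj_point_in_real_gen_ball_iff:
  assumes "z \<noteq> 0"
  shows "proj_point z \<in> real_gen_ball \<longleftrightarrow>
    (\<exists>c x. c \<noteq> 0 \<and> z = c *s x \<and> (\<forall>i. x $ i \<in> \<real>) \<and> herm_form x > 0)"
proof
  assume "proj_point z \<in> real_gen_ball"
  then obtain w where w: "w \<noteq> 0" "proj_point w = proj_point z" "proj_point w \<in> gen_ball"
      "\<And>i j. w $ j \<noteq> 0 \<Longrightarrow> w $ i / w $ j \<in> \<real>"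
    by (auto simp: real_gen_ball_def)
  then obtain c where c: "c \<noteq> 0" "z = c *s w"
    using assms by (auto simp: proj_point_eq_iff)
  obtain j where j: "w $ j \<noteq> 0"
    using w(1) by (auto simp: vec_eq_iff)
  define x where "x = inverse (w $ j) *s w"
  have "\<forall>i. x $ i \<in> \<real>"
    using w(4)[OF j] by (simp add: x_def divide_inverse mult.commute)
  moreover have "herm_form x > 0"
    using w(1,3) j by (simp add: x_def herm_form_scale_pos_iff proj_point_in_gen_ball_iff)
  moreover have "z = (c * w $ j) *s x"
    using c j by (simp add: x_def vector_smult_assoc)
  ultimately show "\<exists>c x. c \<noteq> 0 \<and> z = c *s x \<and> (\<forall>i. x $ i \<in> \<real>) \<and> herm_form x > 0"
    using c(1) j by (metis mult_eq_0_iff)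
next
  assume "\<exists>c x. c \<noteq> 0 \<and> z = c *s x \<and> (\<forall>i. x $ i \<in> \<real>) \<and> herm_form x > 0"
  then obtain c x where "c \<noteq> 0" "z = c *s x" "\<forall>i. x $ i \<in> \<real>" "herm_form x > 0"
    by blast
  moreover from this have "x \<noteq> 0"
    by auto
  ultimately show "proj_point z \<in> real_gen_ball"
    by (auto simp: real_gen_ball_def proj_point_scale proj_point_in_gen_ball_iff)
qed

text \<open>The map \<open>f\<close> comes for free: \<open>M\<close> commutes with scalars, so
  \<open>[M z]\<close> does not depend on the representative of \<open>[z]\<close>.\<close>

lemma defines_linear_self_map_iff:
  assumes S: "S \<subseteq> proj_space"
  shows "defines_linear_self_map M S \<longleftrightarrow>
    (\<forall>z. z \<noteq> 0 \<and> proj_point z \<in> S \<longrightarrow> M *v z \<noteq> 0 \<and> proj_point (M *v z) \<in> S)"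
proof
  assume "defines_linear_self_map M S"
  then show "\<forall>z. z \<noteq> 0 \<and> proj_point z \<in> S \<longrightarrow> M *v z \<noteq> 0 \<and> proj_point (M *v z) \<in> S"
    unfolding defines_linear_self_map_def by (metis Pi_mem)
next
  assume M: "\<forall>z. z \<noteq> 0 \<and> proj_point z \<in> S \<longrightarrow> M *v z \<noteq> 0 \<and> proj_point (M *v z) \<in> S"
  \<comment> \<open>A choice of homogeneous coordinates, meaningful only when \<open>P\<close> is a
    point of projective space.\<close>
  define r where "r P = (SOME z. z \<noteq> 0 \<and> proj_point z = P)" for P :: "(complex ^ 'a) set"
  have r: "r (proj_point z) \<noteq> 0 \<and> proj_point (r (proj_point z)) = proj_point z" if "z \<noteq> 0" for z
    unfolding r_def by (rule someI[of _ z]) (use that in simp)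
  define f where "f P = proj_point (M *v r P)" for P
  have f: "f (proj_point z) = proj_point (M *v z)" if z: "z \<noteq> 0" "proj_point z \<in> S" for z
  proof -
    obtain c where c: "c \<noteq> 0" "r (proj_point z) = c *s z"
      using r[OF z(1)] z(1) by (metis proj_point_eq_iff)
    then show ?thesis
      using M z by (simp add: f_def vector_scalar_commute proj_point_scale)
  qed
  have "f \<in> S \<rightarrow> S"
  proof
    fix P assume P: "P \<in> S"
    then obtain z where "z \<noteq> 0" "P = proj_point z"
      using S by (auto simp: proj_space_def proj_point_def elim!: quotientE)
    with P M f show "f P \<in> S"
      by auto
  qed
  with f M show "defines_linear_self_map M S"
    unfolding defines_linear_self_map_def by blast
qed

lemma gen_ball_subset: "gen_ball \<subseteq> proj_space"
  by (auto simp: gen_ball_def proj_point_in_proj_space_iff)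

lemma real_gen_ball_subset: "real_gen_ball \<subseteq> proj_space"
  by (auto simp: real_gen_ball_def proj_point_in_proj_space_iff)

text \<open>Positivity of \<open>herm_form (M *v z)\<close> already forces
  \<open>M *v z \<noteq> 0\<close>, so it covers well-definedness too.\<close>

lemma self_map_gen_ball_iff:
  fixes M :: "complex ^ ('p::finite + 'q::finite) ^ ('p + 'q)"
  shows "defines_linear_self_map M gen_ball \<longleftrightarrow> (\<forall>z. herm_form z > 0 \<longrightarrow> herm_form (M *v z) > 0)"
  unfolding defines_linear_self_map_iff[OF gen_ball_subset]
  by (metis herm_form_zero less_irrefl proj_point_in_gen_ball_iff)

lemma self_map_real_gen_ball_iff:
  fixes M :: "complex ^ ('p::finite + 'q::finite) ^ ('p + 'q)"
  assumes M: "\<forall>i j. M $ i $ j \<in> \<real>"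
  shows "defines_linear_self_map M real_gen_ball \<longleftrightarrow>
    (\<forall>x. (\<forall>i. x $ i \<in> \<real>) \<and> herm_form x > 0 \<longrightarrow> herm_form (M *v x) > 0)"
  unfolding defines_linear_self_map_iff[OF real_gen_ball_subset]
proof (intro iffI allI impI)
  fix x :: "complex ^ ('p + 'q)"
  assume *: "\<forall>z. z \<noteq> 0 \<and> proj_point z \<in> real_gen_ball \<longrightarrow> M *v z \<noteq> 0 \<and> proj_point (M *v z) \<in> real_gen_ball"
    and x: "(\<forall>i. x $ i \<in> \<real>) \<and> herm_form x > 0"
  have "x \<noteq> 0"
    using x by auto
  moreover have "proj_point x \<in> real_gen_ball"
    using x \<open>x \<noteq> 0\<close> by (auto simp: proj_point_in_real_gen_ball_iff intro!: exI[of _ 1] exI[of _ x])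
  ultimately obtain c y where "c \<noteq> 0" "M *v x = c *s y" "herm_form y > 0"
    using * proj_point_in_real_gen_ball_iff[of "M *v x"] by blast
  then show "herm_form (M *v x) > 0"
    by (simp add: herm_form_scale_pos_iff)
next
  fix z :: "complex ^ ('p + 'q)"
  assume *: "\<forall>x. (\<forall>i. x $ i \<in> \<real>) \<and> herm_form x > 0 \<longrightarrow> herm_form (M *v x) > 0"
    and "z \<noteq> 0 \<and> proj_point z \<in> real_gen_ball"
  then obtain c x where c: "c \<noteq> 0" "z = c *s x" "\<forall>i. x $ i \<in> \<real>" "herm_form x > 0"
    by (auto simp: proj_point_in_real_gen_ball_iff)
  have pos: "herm_form (M *v x) > 0"
    using * c by blast
  \<comment> \<open>Here the real entries of \<open>M\<close> matter: \<open>M *v x\<close> is a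
    real representative of the image point.\<close>
  have "\<forall>i. (M *v x) $ i \<in> \<real>"
    using M c by (auto simp: matrix_vector_mult_def)
  moreover have Mz: "M *v z = c *s (M *v x)"
    using c by (simp add: vector_scalar_commute)
  moreover have "M *v z \<noteq> 0"
    using Mz pos c by auto
  ultimately show "M *v z \<noteq> 0 \<and> proj_point (M *v z) \<in> real_gen_ball"
    using c(1) pos proj_point_in_real_gen_ball_iff by blast
qed

theorem theorem4p5:
  fixes M :: "complex ^ ('p::finite + 'q::finite) ^ ('p + 'q)"
  assumes "\<forall>i j. M $ i $ j \<in> \<real>"
  shows "defines_linear_self_map M gen_ball \<longleftrightarrow> defines_linear_self_map M real_gen_ball"
  unfolding self_map_gen_ball_iff self_map_real_gen_ball_iff[OF assms]
  \<comment> \<open>From left to right, restrict to real vectors; the converse is the splitting into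
    real and imaginary parts.\<close>
  using herm_form_mult_pos[OF assms] by blast

end
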